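(* Let $S:\mathbb{R}^n\times\mathbb{R}^m\to\mathbb{R}$ be convex-concave and continuously differentiable, and suppose that $S$ has at least one saddle point. Let $\rho>0$ and, for $x,z\in\mathbb{R}^n$ and $y,w\in\mathbb{R}^m$, define the regularized function $$S_\rho(x,z,y,w):=\frac{1}{2\rho}\|x-z\|^2+S(x,y)-\frac{1}{2\rho}\|y-w\|^2 .$$ Then the function $$h(x,z,y,w):=\begin{bmatrix}\frac{1}{2\rho}\|y-w\|^2\\[2pt] \frac{1}{2\rho}\|x-z\|^2\end{bmatrix}$$ is an observable certificate of $S_\rho$.
   Context: $\|\cdot\|$ is the Euclidean norm, and inequalities between vectors are entrywise. Convex-concave: $S(\cdot,y)$ is convex for every $y\in\mathbb{R}^m$ and $S(x,\cdot)$ is concave for every $x\in\mathbb{R}^n$. Saddle point of $S$: a point $(x_\star,y_\star)$ such that $S(x_\star,y)\le S(x_\star,y_\star)\le S(x,y_\star)$ for all $x\in\mathbb{R}^n$, $y\in\mathbb{R}^m$. For $S_\rho$ the minimization variable is $(x,z)$ and the maximization variable is $(y,w)$: a point $(x_\star,z_\star,y_\star,w_\star)$ is a saddle point of $S_\rho$ if $S_\rho(x_\star,z_\star,y,w)\le S_\rho(x_\star,z_\star,y_\star,w_\star)\le S_\rho(x,z,y_\star,w_\star)$ for all $x,z\in\mathbb{R}^n$, $y,w\in\mathbb{R}^m$. Regularized saddle flow dynamics (the saddle flow of $S_\rho$: gradient descent in $(x,z)$, gradient ascent in $(y,w)$): $$\dot x=-\nabla_xS(x,y)-\tfrac1\rho(x-z),\quad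 \dot z=\tfrac1\rho(x-z),\quad \dot y=+\nabla_yS(x,y)-\tfrac1\rho(y-w),\quad \dot w=\tfrac1\rho(y-w).$$ Observable certificate of $S_\rho$: a function $h:\mathbb{R}^{n}\times\mathbb{R}^n\times\mathbb{R}^{m}\times\mathbb{R}^m\to\mathbb{R}^2_{\ge0}$ such that (i) there exists a saddle point $(x_\star,z_\star,y_\star,w_\star)$ of $S_\rho$ with $$\begin{bmatrix} S_\rho(x_\star,z_\star,y_\star,w_\star)-S_\rho(x_\star,z_\star,y,w)\\ S_\rho(x,z,y_\star,w_\star)-S_\rho(x_\star,z_\star,y_\star,w_\star)\end{bmatrix}\ge h(x,z,y,w)\ge 0\quad\text{for all }(x,z,y,w),$$ and (ii) for any trajectory of the regularized saddle flow dynamics along which $h(x(t),z(t),y(t),w(t))\equiv0$, we have $\dot x,\dot z,\dot y,\dot w\equiv 0$. *)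

theory Defs
  imports "HOL-Analysis.Analysis"
begin

definition gradient :: "('a::real_inner \<Rightarrow> real) \<Rightarrow> 'a \<Rightarrow> 'a"
  where "gradient f x = (THE D. GDERIV f x :> D)"

lemma gradient_eq:
  assumes "GDERIV f x :> D"
  shows "gradient f x = D"
  unfolding gradient_def
proof (rule the_equality)
  fix D' assume "GDERIV f x :> D'"
  with assms have "(\<lambda>h. h \<bullet> D') = (\<lambda>h. h \<bullet> D)"
    unfolding gderiv_def by (rule has_derivative_unique[rotated])
  then have "(D' - D) \<bullet> (D' - D) = 0"
    by (metis inner_diff_right right_minus_eq)
  then show "D' = D" by simp
qed (rule assms)

definition continuously_differentiable :: "('a::real_normed_vector \<Rightarrow> 'b::real_normed_vector) \<Rightarrow> bool"
  where "continuously_differentiable f \<longleftrightarrow>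
    (\<exists>f'. (\<forall>p. (f has_derivative blinfun_apply (f' p)) (at p)) \<and> continuous_on UNIV f')"

definition convex_concave :: "('a::real_vector \<Rightarrow> 'b::real_vector \<Rightarrow> real) \<Rightarrow> bool"
  where "convex_concave S \<longleftrightarrow>
    (\<forall>y. convex_on UNIV (\<lambda>x. S x y)) \<and> (\<forall>x. concave_on UNIV (\<lambda>y. S x y))"

definition saddle_point :: "('a \<Rightarrow> 'b \<Rightarrow> real) \<Rightarrow> 'a \<Rightarrow> 'b \<Rightarrow> bool"
  where "saddle_point f a b \<longleftrightarrow> (\<forall>u v. f a v \<le> f a b \<and> f a b \<le> f u b)"

definition regularized ::
  "real \<Rightarrow> (real^'n \<Rightarrow> real^'m \<Rightarrow> real) \<Rightarrow> real^'n \<Rightarrow> real^'n \<Rightarrow> real^'m \<Rightarrow> real^'m \<Rightarrow> real"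
  where "regularized \<rho> S x z y w =
    1 / (2 * \<rho>) * (norm (x - z))\<^sup>2 + S x y - 1 / (2 * \<rho>) * (norm (y - w))\<^sup>2"

(* Trajectories are indexed by time t \<ge> 0; the derivative at t = 0 is one-sided. *)
definition regularized_saddle_flow ::
  "real \<Rightarrow> (real^'n \<Rightarrow> real^'m \<Rightarrow> real) \<Rightarrow>
    (real \<Rightarrow> real^'n) \<Rightarrow> (real \<Rightarrow> real^'n) \<Rightarrow> (real \<Rightarrow> real^'m) \<Rightarrow> (real \<Rightarrow> real^'m) \<Rightarrow> bool"
  where "regularized_saddle_flow \<rho> S x z y w \<longleftrightarrow> (\<forall>t\<ge>0.
    (x has_vector_derivative
      - gradient (\<lambda>u. S u (y t)) (x t) - (1 / \<rho>) *\<^sub>R (x t - z t)) (at t within {0..}) \<and>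
    (z has_vector_derivative (1 / \<rho>) *\<^sub>R (x t - z t)) (at t within {0..}) \<and>
    (y has_vector_derivative
      gradient (\<lambda>v. S (x t) v) (y t) - (1 / \<rho>) *\<^sub>R (y t - w t)) (at t within {0..}) \<and>
    (w has_vector_derivative (1 / \<rho>) *\<^sub>R (y t - w t)) (at t within {0..}))"

(* The order on real^2 is the entrywise one. *)
definition observable_certificate ::
  "real \<Rightarrow> (real^'n \<Rightarrow> real^'m \<Rightarrow> real) \<Rightarrow>
    (real^'n \<Rightarrow> real^'n \<Rightarrow> real^'m \<Rightarrow> real^'m \<Rightarrow> real^2) \<Rightarrow> bool"
  where "observable_certificate \<rho> S h \<longleftrightarrow>
    (\<exists>xs zs ys ws.
      saddle_point (\<lambda>(x, z) (y, w). regularized \<rho> S x z y w) (xs, zs) (ys, ws) \<and>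
      (\<forall>x z y w.
        vector [regularized \<rho> S xs zs ys ws - regularized \<rho> S xs zs y w,
                regularized \<rho> S x z ys ws - regularized \<rho> S xs zs ys ws] \<ge> h x z y w \<and>
        h x z y w \<ge> 0)) \<and>
    (\<forall>x z y w.
      regularized_saddle_flow \<rho> S x z y w \<and> (\<forall>t\<ge>0. h (x t) (z t) (y t) (w t) = 0) \<longrightarrow>
      (\<forall>t\<ge>0.
        (x has_vector_derivative 0) (at t within {0..}) \<and>
        (z has_vector_derivative 0) (at t within {0..}) \<and>
        (y has_vector_derivative 0) (at t within {0..}) \<and>
        (w has_vector_derivative 0) (at t within {0..})))"

end

theory Submission
  imports Defs
begin

text \<open>If \<open>(a, b)\<close> is a saddle point of \<open>S\<close>, then \<open>(a, a, b, b)\<close> is one of the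
  regularized function: its quadratic terms vanish there, and the remaining one supplies exactly
  the lower bound demanded of each component of \<open>h\<close>. Along a trajectory with \<open>h = 0\<close> we have
  \<open>x = z\<close> and \<open>y = w\<close>, hence \<open>z\<close> and \<open>w\<close> have zero derivative, and \<open>x\<close> and \<open>y\<close> inherit it.\<close>

lemma vector_2_le_iff:
  "(vector [a, b] :: real^2) \<le> vector [c, d] \<longleftrightarrow> a \<le> c \<and> b \<le> d"
  by (simp add: less_eq_vec_def forall_2)

lemma zero_le_vector_2_iff: "0 \<le> (vector [a, b] :: real^2) \<longleftrightarrow> 0 \<le> a \<and> 0 \<le> b"
  by (simp add: less_eq_vec_def forall_2)

lemma vector_2_eq_zero_iff: "(vector [a, b] :: real^2) = 0 \<longleftrightarrow> a = 0 \<and> b = 0"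
  by (simp add: vec_eq_iff forall_2)

text \<open>Both quadratic terms vanish at \<open>(a, a, b, b)\<close>. Varying only
  \<open>(y, w)\<close>, or only \<open>(x, z)\<close>, brings back one of them; the rest of the gap
  is a difference of values of \<open>S\<close>, nonnegative by the saddle inequalities.\<close>

lemma regularized_gap_bounds:
  assumes "saddle_point S a b"
  shows "1 / (2 * \<rho>) * (norm (y - w))\<^sup>2
      \<le> regularized \<rho> S a a b b - regularized \<rho> S a a y w"
    and "1 / (2 * \<rho>) * (norm (x - z))\<^sup>2
      \<le> regularized \<rho> S x z b b - regularized \<rho> S a a b b"
proof -
  have "S a y \<le> S a b" "S a b \<le> S x b"
    using assms unfolding saddle_point_def by blast+
  then show "1 / (2 * \<rho>) * (norm (y - w))\<^sup>2
      \<le> regularized \<rho> S a a b b - regularized \<rho> S a a y w"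
    and "1 / (2 * \<rho>) * (norm (x - z))\<^sup>2
      \<le> regularized \<rho> S x z b b - regularized \<rho> S a a b b"
    by (simp_all add: regularized_def)
qed

text \<open>For positive \<open>\<rho>\<close> the quadratic lower bounds on the two gaps are
  nonnegative, hence so are the gaps.\<close>

lemma saddle_point_regularized:
  assumes "saddle_point S a b" and "\<rho> > 0"
  shows "saddle_point (\<lambda>(x, z) (y, w). regularized \<rho> S x z y w) (a, a) (b, b)"
proof -
  have "regularized \<rho> S a a y w \<le> regularized \<rho> S a a b b"
    and "regularized \<rho> S a a b b \<le> regularized \<rho> S x z b b" for x z y w
  proof -
    have "0 \<le> 1 / (2 * \<rho>) * (norm (y - w))\<^sup>2" "0 \<le> 1 / (2 * \<rho>) * (norm (x - z))\<^sup>2"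
      using \<open>\<rho> > 0\<close> by simp_all
    then show "regularized \<rho> S a a y w \<le> regularized \<rho> S a a b b"
      and "regularized \<rho> S a a b b \<le> regularized \<rho> S x z b b"
      using regularized_gap_bounds[OF assms(1), of \<rho>] by (meson diff_ge_0_iff_ge order_trans)+
  qed
  then show ?thesis by (auto simp: saddle_point_def)
qed

lemma regularized_saddle_flow_stationary:
  assumes flow: "regularized_saddle_flow \<rho> S x z y w"
    and xz: "\<And>t. t \<ge> 0 \<Longrightarrow> x t = z t" and yw: "\<And>t. t \<ge> 0 \<Longrightarrow> y t = w t"
    and t: "t \<ge> 0"
  shows "(x has_vector_derivative 0) (at t within {0..})"
    and "(z has_vector_derivative 0) (at t within {0..})"
    and "(y has_vector_derivative 0) (at t within {0..})"
    and "(w has_vector_derivative 0) (at t within {0..})"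
proof -
  show z: "(z has_vector_derivative 0) (at t within {0..})"
    and w: "(w has_vector_derivative 0) (at t within {0..})"
    using flow xz[OF t] yw[OF t] t unfolding regularized_saddle_flow_def by force+
  \<comment> \<open>The derivative within \<open>{0..}\<close> depends only on values there, where
    \<open>x\<close> agrees with \<open>z\<close>; this covers the one-sided case t = 0 and avoids
    evaluating any gradient of \<open>S\<close>.\<close>
  show "(x has_vector_derivative 0) (at t within {0..})"
    by (rule has_vector_derivative_transform[OF _ _ z]) (use t xz in auto)
  show "(y has_vector_derivative 0) (at t within {0..})"
    by (rule has_vector_derivative_transform[OF _ _ w]) (use t yw in auto)
qed

theorem proposition7:
  fixes S :: "real^'n \<Rightarrow> real^'m \<Rightarrow> real" and \<rho> :: real
  assumes "convex_concave S"
    and "continuously_differentiable (\<lambda>(x, y). S x y)"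
    and "\<exists>xs ys. saddle_point S xs ys"
    and "\<rho> > 0"
  shows "observable_certificate \<rho> S
    (\<lambda>x z y w. vector [1 / (2 * \<rho>) * (norm (y - w))\<^sup>2, 1 / (2 * \<rho>) * (norm (x - z))\<^sup>2])"
  unfolding observable_certificate_def vector_2_le_iff zero_le_vector_2_iff vector_2_eq_zero_iff
\<comment> \<open>Requiring an existential as first conjunct splits only the two certificate
  conditions and keeps the four derivative claims together.\<close>
proof (intro conjI[where P = "\<exists>xs. _ xs"] allI impI)
  obtain a b where ab: "saddle_point S a b"
    using assms(3) by blast
  show "\<exists>xs zs ys ws.
      saddle_point (\<lambda>(x, z) (y, w). regularized \<rho> S x z y w) (xs, zs) (ys, ws) \<and>
      (\<forall>x z y w.
        (1 / (2 * \<rho>) * (norm (y - w))\<^sup>2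
            \<le> regularized \<rho> S xs zs ys ws - regularized \<rho> S xs zs y w \<and>
          1 / (2 * \<rho>) * (norm (x - z))\<^sup>2
            \<le> regularized \<rho> S x z ys ws - regularized \<rho> S xs zs ys ws) \<and>
        0 \<le> 1 / (2 * \<rho>) * (norm (y - w))\<^sup>2 \<and> 0 \<le> 1 / (2 * \<rho>) * (norm (x - z))\<^sup>2)"
    using saddle_point_regularized[OF ab \<open>\<rho> > 0\<close>] regularized_gap_bounds[OF ab, of \<rho>] \<open>\<rho> > 0\<close>
    \<comment> \<open>The types select the witnesses: \<open>a\<close> for \<open>xs\<close> and
      \<open>zs\<close>, \<open>b\<close> for \<open>ys\<close> and \<open>ws\<close>.\<close>
    by (intro exI[of _ a] exI[of _ b] conjI allI) simp_all
next
  fix x z :: "real \<Rightarrow> real^'n" and y w :: "real \<Rightarrow> real^'m" and t :: real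
  assume *: "regularized_saddle_flow \<rho> S x z y w \<and>
    (\<forall>t\<ge>0. 1 / (2 * \<rho>) * (norm (y t - w t))\<^sup>2 = 0 \<and> 1 / (2 * \<rho>) * (norm (x t - z t))\<^sup>2 = 0)"
    and "t \<ge> 0"
  \<comment> \<open>The factor \<open>1 / (2 * \<rho>)\<close> is nonzero, so the norms themselves
    vanish.\<close>
  have "x s = z s" "y s = w s" if "s \<ge> 0" for s
    using * that \<open>\<rho> > 0\<close> by auto
  with * \<open>t \<ge> 0\<close> show "(x has_vector_derivative 0) (at t within {0..}) \<and>
      (z has_vector_derivative 0) (at t within {0..}) \<and>
      (y has_vector_derivative 0) (at t within {0..}) \<and>
      (w has_vector_derivative 0) (at t within {0..})"
    by (blast intro: regularized_saddle_flow_stationary)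
qed

end
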